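(* Consider the linear stochastic evolution equation $dU=AU\,dt+\sigma(p)B\,dW$ on $H$, where $A=A(p)$. Assume that $A=A(p)$ has a discrete spectrum with eigenvalues $\lambda_k=\lambda_k(p)$ satisfying $\mathrm{Re}(\lambda_k)<0$ for all $k$ and all $p<0$, and eigenfunctions $u_k$. Assume $k^*$ is such that $\lambda_{k^*}$ is a purely imaginary eigenvalue for $p=0$ and set $$\Xi:=\lim_{p\to 0^-}\frac{\sigma^2(p)}{2\,\mathrm{Re}(\lambda_{k^*}(p))}.$$ Then $$\lim_{p\to 0^-}\langle V_\infty u_{k^*},u_{k^*}\rangle=-\langle BQB^*u_{k^*},u_{k^*}\rangle\,\Xi .$$ In particular, if also the genericity condition $\langle BQB^*u_{k^*},u_{k^*}\rangle\neq 0$ holds, then $$\langle V_\infty u_{k^*},u_{k^*}\rangle=\mathcal{O}\!\left(\frac{\sigma^2(p)}{\mathrm{Re}(\lambda_{k^*}(p))}\right)\quad\text{as } p\to 0^-.$$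
   Context: $H$ is a Hilbert space with inner product $\langle\cdot,\cdot\rangle$. $p\in\mathbb{R}$ is a parameter, and for each $p$ the operator $A=A(p):\mathcal{D}(A)\subset H\to H$ is linear and generates a strongly continuous semigroup $e^{tA}$. $W$ is a (possibly generalized) Wiener process on $H$ with covariance operator $Q$, a non-negative self-adjoint operator on $H$; $\sigma=\sigma(p)>0$ is a noise level depending on the parameter $p$; $B$ is a linear operator that is Hilbert–Schmidt from $Q^{1/2}H$ to $H$; the initial condition is $U(0)=0$. A star denotes the adjoint. The mild solution is $U(t)=\sigma(p)\int_0^t e^{(t-s)A}B\,dW_s$, and its covariance operator is $$V(t)=\sigma(p)^2\int_0^t e^{\tau A}BQB^*e^{\tau A^*}\,d\tau .$$ For $p<0$ the steady state $0$ of $\partial_t U=A(p)U$ is stable, and $V_\infty:=\lim_{t\to\infty}V(t)$ satisfies the Lyapunov equation $\langle AV_\infty g,h\rangle+\langle V_\infty A^*g,h\rangle=-\sigma(p)^2\langle BQB^*g,h\rangle$ for all $g,h$ for which the expression is well defined. The limit defining $\Xi$ is understood to exist in $[-\infty,0]$, with the convention $0\cdot(-\infty)=0$.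
   Formalization: Added, since the claim fails for non-normal A(p): for p<0 the eigenfunction u_{k*} of A(p) is also an eigenfunction of the adjoint A(p)* with eigenvalue the conjugate of λ_{k*}(p); u_{k*} is taken to be independent of p for p<0. *)

theory Defs
  imports "HOL-Analysis.Analysis" "HOL-Library.Landau_Symbols"
begin

section \<open>Complex Hilbert spaces\<close>

text \<open>
  The inner product is linear in its first and conjugate-linear in its second argument. Separability
  is not required. Positive definiteness is contained in \<open>cinner_norm\<close>, the norm being definite.
\<close>

class complex_hilbert = banach +
  fixes scaleC :: "complex \<Rightarrow> 'a \<Rightarrow> 'a"  (infixr "*\<^sub>C" 75)
    and cinner :: "'a \<Rightarrow> 'a \<Rightarrow> complex"
  assumes scaleC_add_right: "a *\<^sub>C (x + y) = a *\<^sub>C x + a *\<^sub>C y"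
    and scaleC_add_left: "(a + b) *\<^sub>C x = a *\<^sub>C x + b *\<^sub>C x"
    and scaleC_scaleC: "a *\<^sub>C (b *\<^sub>C x) = (a * b) *\<^sub>C x"
    and scaleC_of_real: "complex_of_real r *\<^sub>C x = r *\<^sub>R x"
    and cinner_add_left: "cinner (x + y) z = cinner x z + cinner y z"
    and cinner_scaleC_left: "cinner (a *\<^sub>C x) y = a * cinner x y"
    and cinner_commute: "cinner x y = cnj (cinner y x)"
    and cinner_norm: "cinner x x = complex_of_real ((norm x)\<^sup>2)"

instantiation complex :: complex_hilbert
begin
definition "scaleC (a::complex) (x::complex) = a * x"
definition "cinner (x::complex) (y::complex) = x * cnj y"
instance
proof
  fix x y z a b :: complex and r :: real
  show "cinner x y = cnj (cinner y x)"
    by (simp add: cinner_complex_def mult.commute)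
  show "cinner x x = complex_of_real ((norm x)\<^sup>2)"
    unfolding cinner_complex_def by (rule complex_norm_square [symmetric])
qed (simp_all add: scaleC_complex_def cinner_complex_def ring_distribs mult.assoc
    scaleR_conv_of_real)
end

definition bounded_clinear :: "('a::complex_hilbert \<Rightarrow> 'b::complex_hilbert) \<Rightarrow> bool" where
  "bounded_clinear T \<longleftrightarrow> bounded_linear T \<and> (\<forall>c x. T (c *\<^sub>C x) = c *\<^sub>C T x)"


section \<open>Unbounded operators\<close>

text \<open>
  A possibly unbounded operator is a pair of a domain \<open>D\<close> and a function \<open>A\<close>, whose
  values outside \<open>D\<close> are irrelevant; \<open>D = UNIV\<close> for bounded operators.
\<close>

definition adj_domain :: "'a::complex_hilbert set \<Rightarrow> ('a \<Rightarrow> 'a) \<Rightarrow> 'a set" where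
  "adj_domain D A = {y. \<exists>z. \<forall>x\<in>D. cinner (A x) y = cinner x z}"

text \<open>The description below determines \<open>z\<close> when \<open>D\<close> is dense, as it is for generators.\<close>

definition adjoint_op :: "'a::complex_hilbert set \<Rightarrow> ('a \<Rightarrow> 'a) \<Rightarrow> 'a \<Rightarrow> 'a" where
  "adjoint_op D A y = (THE z. \<forall>x\<in>D. cinner (A x) y = cinner x z)"

definition eigenvector :: "'a::complex_hilbert set \<Rightarrow> ('a \<Rightarrow> 'a) \<Rightarrow> complex \<Rightarrow> 'a \<Rightarrow> bool" where
  "eigenvector D A \<mu> u \<longleftrightarrow> u \<in> D \<and> u \<noteq> 0 \<and> A u = \<mu> *\<^sub>C u"

definition resolvent_set :: "'a::complex_hilbert set \<Rightarrow> ('a \<Rightarrow> 'a) \<Rightarrow> complex set" where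
  "resolvent_set D A = {\<mu>. bij_betw (\<lambda>x. \<mu> *\<^sub>C x - A x) D UNIV \<and>
     (\<exists>C. \<forall>x\<in>D. norm x \<le> C * norm (\<mu> *\<^sub>C x - A x))}"

definition spectrum :: "'a::complex_hilbert set \<Rightarrow> ('a \<Rightarrow> 'a) \<Rightarrow> complex set" where
  "spectrum D A = - resolvent_set D A"

text \<open>
  The spectrum consists of isolated eigenvalues. Some authors also require finite multiplicity;
  this is not demanded here, so that the notion is the more general one.
\<close>

definition discrete_spectrum :: "'a::complex_hilbert set \<Rightarrow> ('a \<Rightarrow> 'a) \<Rightarrow> bool" where
  "discrete_spectrum D A \<longleftrightarrow>
     (\<forall>\<mu>\<in>spectrum D A. (\<exists>u. eigenvector D A \<mu> u) \<and> \<not> \<mu> islimpt spectrum D A)"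


section \<open>Strongly continuous semigroups\<close>

definition C0_semigroup :: "(real \<Rightarrow> 'a::complex_hilbert \<Rightarrow> 'a) \<Rightarrow> bool" where
  "C0_semigroup S \<longleftrightarrow>
     (\<forall>t\<ge>0. bounded_clinear (S t)) \<and>
     (\<forall>x. S 0 x = x) \<and>
     (\<forall>s\<ge>0. \<forall>t\<ge>0. \<forall>x. S (s + t) x = S s (S t x)) \<and>
     (\<forall>x. ((\<lambda>t. S t x) \<longlongrightarrow> x) (at_right 0))"

definition generates ::
    "'a::complex_hilbert set \<Rightarrow> ('a \<Rightarrow> 'a) \<Rightarrow> (real \<Rightarrow> 'a \<Rightarrow> 'a) \<Rightarrow> bool" where
  "generates D A S \<longleftrightarrow>
     C0_semigroup S \<and>
     D = {x. \<exists>y. ((\<lambda>h. (S h x - x) /\<^sub>R h) \<longlongrightarrow> y) (at_right 0)} \<and>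
     (\<forall>x\<in>D. ((\<lambda>h. (S h x - x) /\<^sub>R h) \<longlongrightarrow> A x) (at_right 0))"

text \<open>Stability, in the sense of Lyapunov, of the steady state \<open>0\<close>.\<close>

definition stable_at_zero :: "(real \<Rightarrow> 'a::complex_hilbert \<Rightarrow> 'a) \<Rightarrow> bool" where
  "stable_at_zero S \<longleftrightarrow>
     (\<forall>\<epsilon>>0. \<exists>\<delta>>0. \<forall>x. norm x < \<delta> \<longrightarrow> (\<forall>t\<ge>0. norm (S t x) < \<epsilon>))"


section \<open>Noise\<close>

definition nonneg_selfadjoint :: "('a::complex_hilbert \<Rightarrow> 'a) \<Rightarrow> bool" where
  "nonneg_selfadjoint T \<longleftrightarrow>
     bounded_clinear T \<and>
     (\<forall>x y. cinner (T x) y = cinner x (T y)) \<and>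
     (\<forall>x. 0 \<le> Re (cinner (T x) x))"

text \<open>\<open>R\<close> is \<open>Q\<^sup>1\<^sup>/\<^sup>2\<close>.\<close>

definition is_sqrt_op :: "('a::complex_hilbert \<Rightarrow> 'a) \<Rightarrow> ('a \<Rightarrow> 'a) \<Rightarrow> bool" where
  "is_sqrt_op R Q \<longleftrightarrow> nonneg_selfadjoint R \<and> R \<circ> R = Q"

text \<open>
  The space \<open>Q\<^sup>1\<^sup>/\<^sup>2 H = range R\<close> carries the inner product
  \<open>\<langle>R\<^sup>-\<^sup>1 x, R\<^sup>-\<^sup>1 y\<rangle>\<close>, where \<open>R\<^sup>-\<^sup>1\<close> is the pseudo-inverse of \<open>R\<close>, which picks the preimage
  orthogonal to the kernel of \<open>R\<close>.
\<close>

definition pseudo_inverse :: "('a::complex_hilbert \<Rightarrow> 'a) \<Rightarrow> 'a \<Rightarrow> 'a" where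
  "pseudo_inverse R x = (THE y. R y = x \<and> (\<forall>z. R z = 0 \<longrightarrow> cinner y z = 0))"

definition range_inner :: "('a::complex_hilbert \<Rightarrow> 'a) \<Rightarrow> 'a \<Rightarrow> 'a \<Rightarrow> complex" where
  "range_inner R x y = cinner (pseudo_inverse R x) (pseudo_inverse R y)"

text \<open>
  In the next two definitions \<open>X\<close> is a linear subspace that is a Hilbert space under the inner
  product \<open>ip\<close>. In a Hilbert space the orthonormal bases are the maximal orthonormal sets.
\<close>

definition orthonormal_basis ::
    "'a set \<Rightarrow> ('a \<Rightarrow> 'a \<Rightarrow> complex) \<Rightarrow> 'a::complex_hilbert set \<Rightarrow> bool" where
  "orthonormal_basis X ip E \<longleftrightarrow>
     E \<subseteq> X \<and>
     (\<forall>e\<in>E. \<forall>f\<in>E. ip e f = (if e = f then 1 else 0)) \<and>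
     (\<forall>x\<in>X. (\<forall>e\<in>E. ip x e = 0) \<longrightarrow> x = 0)"

definition hilbert_schmidt ::
    "'a::complex_hilbert set \<Rightarrow> ('a \<Rightarrow> 'a \<Rightarrow> complex) \<Rightarrow> ('a \<Rightarrow> 'a) \<Rightarrow> bool" where
  "hilbert_schmidt X ip T \<longleftrightarrow>
     (\<forall>x\<in>X. \<forall>y\<in>X. T (x + y) = T x + T y) \<and>
     (\<forall>c. \<forall>x\<in>X. T (c *\<^sub>C x) = c *\<^sub>C T x) \<and>
     (\<exists>C. \<forall>x\<in>X. norm (T x) \<le> C * sqrt (Re (ip x x))) \<and>
     (\<exists>E. orthonormal_basis X ip E \<and> (\<lambda>e. (norm (T e))\<^sup>2) summable_on E)"

text \<open>
  The operator \<open>B\<close> is only given on \<open>Q\<^sup>1\<^sup>/\<^sup>2 H\<close> and may be unbounded on \<open>H\<close>. As usual,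
  \<open>B Q B\<^sup>*\<close> then stands for \<open>(B Q\<^sup>1\<^sup>/\<^sup>2) (B Q\<^sup>1\<^sup>/\<^sup>2)\<^sup>*\<close>, where \<open>B Q\<^sup>1\<^sup>/\<^sup>2\<close> is a bounded
  operator on \<open>H\<close>. If \<open>B\<close> has an everywhere defined adjoint, this is the plain composition
  (lemma \<open>noise_cov_eq\<close>).
\<close>

definition noise_cov ::
    "('a::complex_hilbert \<Rightarrow> 'a) \<Rightarrow> ('a \<Rightarrow> 'a) \<Rightarrow> 'a \<Rightarrow> 'a" where
  "noise_cov R B = (B \<circ> R) \<circ> adjoint_op UNIV (B \<circ> R)"

lemma adjoint_op_UNIV_eq:
  fixes T T' :: "'a::complex_hilbert \<Rightarrow> 'a"
  assumes "\<And>x y. cinner (T x) y = cinner x (T' y)"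
  shows "adjoint_op UNIV T = T'"
proof
  fix y
  show "adjoint_op UNIV T y = T' y"
    unfolding adjoint_op_def
  proof (rule the_equality)
    show "\<forall>x\<in>UNIV. cinner (T x) y = cinner x (T' y)"
      using assms by blast
  next
    fix z assume z: "\<forall>x\<in>UNIV. cinner (T x) y = cinner x z"
    define w where "w = z - T' y"
    have "cinner z w = cinner (T' y) w"
      using z assms by (metis UNIV_I cinner_commute)
    moreover have "cinner z w = cinner w w + cinner (T' y) w"
      unfolding w_def by (metis cinner_add_left diff_add_cancel)
    ultimately have "cinner w w = 0" by simp
    then show "z = T' y" by (simp add: cinner_norm w_def)
  qed
qed

lemma noise_cov_eq:
  fixes B B' Q R :: "'a::complex_hilbert \<Rightarrow> 'a"
  assumes "is_sqrt_op R Q" and "\<And>x y. cinner (B x) y = cinner x (B' y)"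
  shows "noise_cov R B = B \<circ> Q \<circ> B'"
proof -
  have "cinner ((B \<circ> R) x) y = cinner x ((R \<circ> B') y)" for x y
    using assms by (simp add: is_sqrt_op_def nonneg_selfadjoint_def)
  then have "adjoint_op UNIV (B \<circ> R) = R \<circ> B'"
    by (rule adjoint_op_UNIV_eq)
  then show ?thesis
    using assms(1) by (auto simp: noise_cov_def is_sqrt_op_def fun_eq_iff)
qed

text \<open>
  The covariance operator of the mild solution \<open>U(t) = s \<integral>\<^sub>0\<^sup>t e\<^sup>(\<^sup>t\<^sup>-\<^sup>\<tau>\<^sup>)\<^sup>A B dW\<^sub>\<tau>\<close>, for noise level \<open>s\<close>
  and \<open>C = B Q B\<^sup>*\<close>. The operator-valued integral is taken pointwise.
\<close>

definition solution_cov ::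
    "(real \<Rightarrow> 'a::complex_hilbert \<Rightarrow> 'a) \<Rightarrow> ('a \<Rightarrow> 'a) \<Rightarrow> real \<Rightarrow> real \<Rightarrow> 'a \<Rightarrow> 'a" where
  "solution_cov S C s t g =
     s\<^sup>2 *\<^sub>R integral {0..t} (\<lambda>\<tau>. S \<tau> (C (adjoint_op UNIV (S \<tau>) g)))"

end

theory Submission
  imports Defs
begin

text \<open>
  Write \<open>C = BQB\<^sup>*\<close>. Since \<open>u\<close> is an eigenvector of \<open>A\<^sup>*\<close> for the conjugate of \<open>\<lambda>\<close>, it is also
  one of \<open>(e\<^sup>\<tau>\<^sup>A)\<^sup>*\<close>, with eigenvalue the conjugate of \<open>exp (\<lambda>\<tau>)\<close>. Moving one semigroup factor onto
  each side of the inner product collapses the integrand of the covariance to a scalar exponential,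
  \<open>\<langle>e\<^sup>\<tau>\<^sup>A C (e\<^sup>\<tau>\<^sup>A)\<^sup>* u, u\<rangle> = exp (2 Re \<lambda> \<tau>) \<langle>C u, u\<rangle>\<close>. Integrating over \<open>[0, \<infinity>)\<close> gives the exact identity
  \<open>\<langle>V\<^sub>\<infinity> u, u\<rangle> = - \<sigma>\<^sup>2 / (2 Re \<lambda>) \<langle>C u, u\<rangle>\<close> for every \<open>p < 0\<close>
  (\<open>stationary_variance_adjoint_eigenvector\<close>). The limit and the growth bound as \<open>p\<close> tends to
  \<open>0\<close> from the left can be read off, because \<open>C\<close> and \<open>u\<close> do not vary with \<open>p\<close>.

  Two points carry the work. First, the passage from \<open>A\<^sup>*\<close> to \<open>(e\<^sup>\<tau>\<^sup>A)\<^sup>*\<close>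
  (\<open>cinner_orbit_adjoint_eigenvector\<close>): the integrated orbit \<open>\<integral>\<^sub>0\<^sup>t e\<^sup>s\<^sup>A x ds\<close> lies in the domain and
  \<open>A\<close> maps it to \<open>e\<^sup>t\<^sup>A x - x\<close>, so that \<open>\<phi>(t) = \<langle>e\<^sup>t\<^sup>A x, u\<rangle>\<close> solves \<open>\<phi>(t) = \<phi>(0) + \<lambda> \<integral>\<^sub>0\<^sup>t \<phi>\<close>
  for arbitrary \<open>x\<close>. Stability supplies a uniform bound on the semigroup and hence continuous orbits. Secondly, \<open>C\<close> has to be linear with
  real quadratic form. It equals \<open>T T\<^sup>*\<close> for \<open>T = B Q\<^sup>1\<^sup>/\<^sup>2\<close>, which the Hilbert--Schmidt hypothesis
  makes a bounded operator on \<open>H\<close> (\<open>hilbert_schmidt_comp_bounded\<close>), and the Riesz representation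
  theorem provides \<open>T\<^sup>*\<close>.
\<close>

section \<open>Complex inner products\<close>

lemma cinner_add_right: "cinner x (y + z) = cinner x y + cinner x z"
  by (metis cinner_add_left cinner_commute complex_cnj_add)

lemma cinner_scaleC_right: "cinner x (c *\<^sub>C y) = cnj c * cinner x y"
  by (metis cinner_commute cinner_scaleC_left complex_cnj_mult)

lemma scaleC_minus_one: "(-1) *\<^sub>C x = - (x::'a::complex_hilbert)"
  using scaleC_of_real[of "-1" x] by simp

lemma cinner_minus_left: "cinner (- x) y = - cinner x y"
  using cinner_scaleC_left[of "-1" x y] by (simp add: scaleC_minus_one)

lemma cinner_minus_right: "cinner x (- y) = - cinner x y"
  using cinner_scaleC_right[of x "-1" y] by (simp add: scaleC_minus_one)

lemma cinner_diff_left: "cinner (x - y) z = cinner x z - cinner y z"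
  using cinner_add_left[of x "- y" z] by (simp add: cinner_minus_left)

lemma cinner_diff_right: "cinner x (y - z) = cinner x y - cinner x z"
  using cinner_add_right[of x y "- z"] by (simp add: cinner_minus_right)

lemma cinner_zero_left [simp]: "cinner 0 y = 0"
  using cinner_diff_left[of 0 0 y] by simp

lemma cinner_zero_right [simp]: "cinner x 0 = 0"
  using cinner_diff_right[of x 0 0] by simp

lemmas cinner_simps = cinner_add_left cinner_add_right cinner_diff_left cinner_diff_right
  cinner_scaleC_left cinner_scaleC_right

lemma cinner_self_eq_0: "cinner x x = 0 \<longleftrightarrow> x = 0"
  by (simp add: cinner_norm)

lemma norm_scaleC: "norm (c *\<^sub>C x) = cmod c * norm (x::'a::complex_hilbert)"
proof -
  have "complex_of_real ((norm (c *\<^sub>C x))\<^sup>2) = c * cnj c * cinner x x"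
    by (simp only: cinner_norm[symmetric] cinner_simps mult_ac)
  also have "\<dots> = complex_of_real ((cmod c * norm x)\<^sup>2)"
    by (simp add: cinner_norm complex_norm_square[symmetric] power_mult_distrib)
  finally show ?thesis
    by (metis norm_ge_zero of_real_eq_iff power2_eq_imp_eq zero_le_mult_iff)
qed

text \<open>
  Subtracting the component along \<open>y\<close> shortens \<open>x\<close> by an explicit amount. That amount yields the
  Cauchy--Schwarz inequality, and it shows that a shortest vector of a coset is orthogonal to the
  subspace.
\<close>

lemma norm_diff_projection:
  assumes "y \<noteq> 0"
  shows "(norm (x - (cinner x y / cinner y y) *\<^sub>C y))\<^sup>2
    = (norm x)\<^sup>2 - (cmod (cinner x y))\<^sup>2 / (norm y)\<^sup>2"
proof -
  let ?c = "cinner x y / cinner y y"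
  have y: "cinner y y \<noteq> 0" using assms by (simp add: cinner_self_eq_0)
  have "complex_of_real ((norm (x - ?c *\<^sub>C y))\<^sup>2) = cinner (x - ?c *\<^sub>C y) (x - ?c *\<^sub>C y)"
    by (simp add: cinner_norm)
  also have "\<dots> = cinner x x - cinner x y * cnj (cinner x y) / cinner y y"
    using y cinner_commute[of y x] cinner_commute[of y y] by (simp add: cinner_simps field_simps)
  also have "\<dots> = complex_of_real ((norm x)\<^sup>2 - (cmod (cinner x y))\<^sup>2 / (norm y)\<^sup>2)"
    by (simp add: cinner_norm complex_norm_square[symmetric])
  finally show ?thesis using of_real_eq_iff by blast
qed

lemma Cauchy_Schwarz_cinner: "cmod (cinner x y) \<le> norm x * norm y"
proof (cases "y = 0")
  case False
  have "(cmod (cinner x y))\<^sup>2 / (norm y)\<^sup>2 \<le> (norm x)\<^sup>2"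
    using norm_diff_projection[OF False, of x] by (smt (verit) zero_le_power2)
  then have "(cmod (cinner x y))\<^sup>2 \<le> (norm x * norm y)\<^sup>2"
    using False by (simp add: field_simps)
  then show ?thesis by (rule power2_le_imp_le) simp
qed simp

lemma parallelogram_law:
  "(norm (x + y))\<^sup>2 + (norm (x - y))\<^sup>2 = 2 * (norm x)\<^sup>2 + 2 * (norm (y::'a::complex_hilbert))\<^sup>2"
proof -
  have "complex_of_real ((norm (x + y))\<^sup>2 + (norm (x - y))\<^sup>2)
      = complex_of_real (2 * (norm x)\<^sup>2 + 2 * (norm y)\<^sup>2)"
    by (simp only: of_real_add of_real_mult cinner_norm[symmetric]) (simp add: cinner_simps)
  then show ?thesis using of_real_eq_iff by blast
qed

lemma bounded_linear_cinner_left: "bounded_linear (\<lambda>x. cinner x y)"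
proof (rule bounded_linear_intro)
  show "cinner (r *\<^sub>R x) y = r *\<^sub>R cinner x y" for r x
    by (simp only: scaleC_of_real[symmetric, of r x] cinner_scaleC_left scaleR_conv_of_real)
qed (rule cinner_add_left, rule Cauchy_Schwarz_cinner)

lemma bounded_bilinear_scaleC:
  "bounded_bilinear (scaleC :: complex \<Rightarrow> 'a::complex_hilbert \<Rightarrow> 'a)"
proof
  fix a :: complex and x :: 'a and r :: real
  show "(r *\<^sub>R a) *\<^sub>C x = r *\<^sub>R a *\<^sub>C x"
    by (simp only: scaleC_of_real[symmetric, of r "a *\<^sub>C x"] scaleC_scaleC scaleR_conv_of_real)
  show "a *\<^sub>C r *\<^sub>R x = r *\<^sub>R a *\<^sub>C x"
    by (simp only: scaleC_of_real[symmetric, of r] scaleC_scaleC mult.commute)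
  show "\<exists>K. \<forall>a (b::'a). norm (a *\<^sub>C b) \<le> norm a * norm b * K"
    by (rule exI[of _ 1]) (simp add: norm_scaleC)
qed (simp_all add: scaleC_add_left scaleC_add_right)

section \<open>Orthogonal projection, Riesz representation and adjoints\<close>

text \<open>
  By the parallelogram law, points of \<open>M\<close> that nearly minimise the distance to \<open>x\<close> are close to each
  other: their midpoint lies in \<open>M\<close> and cannot do better than the infimum. A minimising sequence
  therefore converges, and its limit is the foot of the perpendicular.
\<close>

lemma closed_subspace_projection:
  fixes M :: "'a::complex_hilbert set"
  assumes cl: "closed M" and ne: "0 \<in> M"
    and add: "\<And>y z. y \<in> M \<Longrightarrow> z \<in> M \<Longrightarrow> y + z \<in> M"
    and scale: "\<And>c z. z \<in> M \<Longrightarrow> c *\<^sub>C z \<in> M"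
  shows "\<exists>m\<in>M. \<forall>z\<in>M. cinner (x - m) z = 0"
proof -
  define d where "d = infdist x M"
  have d_le: "d \<le> norm (x - z)" if "z \<in> M" for z
    using infdist_le[OF that, of x] by (simp add: d_def dist_norm)
  have d0: "0 \<le> d" by (simp add: d_def infdist_nonneg)
  have "\<exists>m\<in>M. (norm (x - m))\<^sup>2 \<le> d\<^sup>2 + inverse (real (Suc n))" for n
  proof -
    have "d < sqrt (d\<^sup>2 + inverse (real (Suc n)))"
      using d0 by (intro real_less_rsqrt) simp
    then obtain m where "m \<in> M" "dist x m < sqrt (d\<^sup>2 + inverse (real (Suc n)))"
      unfolding d_def infdist_def using ne
      by (auto simp: cINF_less_iff split: if_splits)
    then have "(norm (x - m))\<^sup>2 < (sqrt (d\<^sup>2 + inverse (real (Suc n))))\<^sup>2"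
      by (intro power_strict_mono) (simp_all add: dist_norm)
    also have "\<dots> = d\<^sup>2 + inverse (real (Suc n))" by (intro real_sqrt_pow2 add_nonneg_nonneg) simp_all
    finally show ?thesis using \<open>m \<in> M\<close> less_imp_le by blast
  qed
  then obtain m where mM: "\<And>n. m n \<in> M"
    and m_le: "\<And>n. (norm (x - m n))\<^sup>2 \<le> d\<^sup>2 + inverse (real (Suc n))"
    by metis
  \<comment> \<open>Parallelogram law for \<open>x - m i\<close> and \<open>x - m j\<close>, whose sum is twice the vector to the midpoint.\<close>
  have gap: "(norm (m i - m j))\<^sup>2 \<le> 2 * inverse (real (Suc i)) + 2 * inverse (real (Suc j))" for i j
  proof -
    have "(1/2) *\<^sub>C (m i + m j) \<in> M" using add scale mM by blast
    then have "d\<^sup>2 \<le> (norm (x - (1/2) *\<^sub>C (m i + m j)))\<^sup>2"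
      using d_le d0 by (simp add: power_mono)
    moreover have "(x - m i) + (x - m j) = 2 *\<^sub>R (x - (1/2) *\<^sub>C (m i + m j))"
      using scaleC_of_real[of "1/2" "m i + m j"]
      by (simp add: scaleR_right_diff_distrib scaleR_2)
    then have "(norm ((x - m i) + (x - m j)))\<^sup>2 = 4 * (norm (x - (1/2) *\<^sub>C (m i + m j)))\<^sup>2"
      by (simp add: power_mult_distrib)
    moreover have "(norm ((x - m i) - (x - m j)))\<^sup>2 = (norm (m i - m j))\<^sup>2"
      by (simp add: norm_minus_commute)
    ultimately show ?thesis
      using parallelogram_law[of "x - m i" "x - m j"] m_le[of i] m_le[of j] by linarith
  qed
  have "Cauchy m"
  proof (rule metric_CauchyI)
    fix e :: real assume e: "0 < e"
    then obtain N where N: "inverse (real (Suc N)) < e\<^sup>2 / 4"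
      using reals_Archimedean[of "e\<^sup>2/4"] by auto
    have "dist (m i) (m j) < e" if "i \<ge> N" "j \<ge> N" for i j
    proof -
      have "inverse (real (Suc i)) \<le> inverse (real (Suc N))"
        "inverse (real (Suc j)) \<le> inverse (real (Suc N))"
        using that by (simp_all add: field_simps)
      then have "(norm (m i - m j))\<^sup>2 < e\<^sup>2" using gap[of i j] N by linarith
      then show ?thesis using e by (simp add: dist_norm power_less_imp_less_base)
    qed
    then show "\<exists>N. \<forall>i\<ge>N. \<forall>j\<ge>N. dist (m i) (m j) < e" by blast
  qed
  then obtain l where l: "m \<longlonglongrightarrow> l" by (auto simp: Cauchy_convergent_iff convergent_def)
  have lM: "l \<in> M" using closed_sequentially[OF cl] mM l by blast
  have "(norm (x - l))\<^sup>2 \<le> d\<^sup>2 + 0"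
  proof (rule LIMSEQ_le)
    show "(\<lambda>n. (norm (x - m n))\<^sup>2) \<longlonglongrightarrow> (norm (x - l))\<^sup>2"
      by (intro tendsto_intros l)
    show "(\<lambda>n. d\<^sup>2 + inverse (real (Suc n))) \<longlonglongrightarrow> d\<^sup>2 + 0"
      by (intro tendsto_intros LIMSEQ_inverse_real_of_nat)
  qed (use m_le in auto)
  have "cinner (x - l) z = 0" if "z \<in> M" for z
  proof (cases "z = 0")
    case False
    let ?c = "cinner (x - l) z / cinner z z"
    have "l + ?c *\<^sub>C z \<in> M" using add scale lM that by blast
    then have "d \<le> norm (x - l - ?c *\<^sub>C z)" using d_le by (metis diff_diff_eq)
    then have "d\<^sup>2 \<le> (norm (x - l - ?c *\<^sub>C z))\<^sup>2" using d0 by (rule power_mono)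
    also have "\<dots> = (norm (x - l))\<^sup>2 - (cmod (cinner (x - l) z))\<^sup>2 / (norm z)\<^sup>2"
      by (rule norm_diff_projection[OF False])
    finally have "(cmod (cinner (x - l) z))\<^sup>2 / (norm z)\<^sup>2 \<le> 0"
      using \<open>(norm (x - l))\<^sup>2 \<le> d\<^sup>2 + 0\<close> by linarith
    then show ?thesis using False by (simp add: divide_le_0_iff)
  qed simp
  with lM show ?thesis by blast
qed

text \<open>
  The kernel of a non-zero functional has codimension one, so a vector orthogonal to it
  represents the functional up to scaling.
\<close>

lemma riesz_representation:
  fixes f :: "'a::complex_hilbert \<Rightarrow> complex"
  assumes bl: "bounded_linear f" and hom: "\<And>c x. f (c *\<^sub>C x) = c * f x"
  shows "\<exists>z. \<forall>x. f x = cinner x z"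
proof (cases "\<forall>x. f x = 0")
  case True
  then show ?thesis by (intro exI[of _ 0]) simp
next
  case False
  then obtain a where a: "f a \<noteq> 0" by blast
  interpret f: bounded_linear f by (rule bl)
  have "closed {x. f x = 0}"
    by (intro closed_Collect_eq f.continuous_on continuous_on_id continuous_on_const)
  then obtain m where m: "f m = 0" and orth: "\<And>z. f z = 0 \<Longrightarrow> cinner (a - m) z = 0"
    using closed_subspace_projection[of "{x. f x = 0}" a] by (auto simp: f.add hom f.zero)
  define w where "w = a - m"
  have fw: "f w \<noteq> 0" using a m by (simp add: w_def f.diff)
  then have w0: "cinner w w \<noteq> 0" using f.zero by (auto simp: cinner_self_eq_0)
  have "f x = cinner x (cnj (f w / cinner w w) *\<^sub>C w)" for x
  proof -
    have "f (x - (f x / f w) *\<^sub>C w) = 0" using fw by (simp add: f.diff hom)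
    then have "cinner w (x - (f x / f w) *\<^sub>C w) = 0" unfolding w_def by (rule orth)
    then have "cinner (x - (f x / f w) *\<^sub>C w) w = 0" by (metis cinner_commute complex_cnj_zero)
    then have "cinner x w = f x / f w * cinner w w" by (simp add: cinner_simps)
    then show ?thesis using fw w0 by (simp add: cinner_simps)
  qed
  then show ?thesis by blast
qed

lemma bounded_clinear_adjoint_exists:
  fixes T :: "'a::complex_hilbert \<Rightarrow> 'a"
  assumes "bounded_clinear T"
  obtains T' where "\<And>x y. cinner (T x) y = cinner x (T' y)"
proof -
  have "\<exists>z. \<forall>x. cinner (T x) y = cinner x z" for y
  proof (rule riesz_representation)
    show "bounded_linear (\<lambda>x. cinner (T x) y)"
      using bounded_linear_compose[OF bounded_linear_cinner_left, of T y] assms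
      by (simp add: bounded_clinear_def)
    show "cinner (T (c *\<^sub>C x)) y = c * cinner (T x) y" for c x
      using assms by (simp add: bounded_clinear_def cinner_scaleC_left)
  qed
  then show ?thesis using that by metis
qed

lemma adjoint_op_eqI:
  fixes D :: "'a::complex_hilbert set"
  assumes dense: "closure D = UNIV" and z: "\<And>x. x \<in> D \<Longrightarrow> cinner (T x) y = cinner x z"
  shows "adjoint_op D T y = z"
  unfolding adjoint_op_def
proof (rule the_equality)
  fix v assume v: "\<forall>x\<in>D. cinner (T x) y = cinner x v"
  have "closed {x. cinner x (v - z) = 0}"
    by (intro closed_Collect_eq continuous_on_const
        bounded_linear.continuous_on[OF bounded_linear_cinner_left] continuous_on_id)
  moreover have "D \<subseteq> {x. cinner x (v - z) = 0}"
    using v z by (auto simp: cinner_diff_right)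
  ultimately have "closure D \<subseteq> {x. cinner x (v - z) = 0}" by (rule closure_minimal[rotated])
  then have "cinner (v - z) (v - z) = 0" using dense by blast
  then show "v = z" by (simp add: cinner_self_eq_0)
qed (use z in blast)

lemma cinner_adjoint_op:
  fixes D :: "'a::complex_hilbert set"
  assumes "closure D = UNIV" "y \<in> adj_domain D T" "x \<in> D"
  shows "cinner (T x) y = cinner x (adjoint_op D T y)"
proof -
  obtain z where z: "\<And>x. x \<in> D \<Longrightarrow> cinner (T x) y = cinner x z"
    using assms(2) by (auto simp: adj_domain_def)
  show ?thesis using z[OF assms(3)] adjoint_op_eqI[OF assms(1) z] by simp
qed

section \<open>The noise covariance\<close>

text \<open>
  The pseudo-inverse at \<open>R x\<close> is the component of \<open>x\<close> orthogonal to the kernel of \<open>R\<close>. Thus the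
  norm of \<open>R x\<close> in the range space is at most the norm of \<open>x\<close>, which turns boundedness on the range
  space into boundedness on \<open>H\<close>.
\<close>

lemma pseudo_inverse_norm_le:
  assumes "bounded_clinear R"
  shows "norm (pseudo_inverse R (R x)) \<le> norm x"
proof -
  interpret R: bounded_linear R using assms by (simp add: bounded_clinear_def)
  have hom: "R (c *\<^sub>C x) = c *\<^sub>C R x" for c x using assms by (simp add: bounded_clinear_def)
  have "closed {x. R x = 0}"
    by (intro closed_Collect_eq R.continuous_on continuous_on_id continuous_on_const)
  moreover have "c *\<^sub>C 0 = (0::'a)" for c
    using norm_scaleC[of c "0::'a"] by simp
  ultimately obtain m where m: "R m = 0" and orth: "\<And>z. R z = 0 \<Longrightarrow> cinner (x - m) z = 0"
    using closed_subspace_projection[of "{x. R x = 0}" x] by (auto simp: R.add hom R.zero)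
  have "pseudo_inverse R (R x) = x - m"
    unfolding pseudo_inverse_def
  proof (rule the_equality)
    show "R (x - m) = R x \<and> (\<forall>z. R z = 0 \<longrightarrow> cinner (x - m) z = 0)"
      using m orth by (simp add: R.diff)
  next
    fix y assume y: "R y = R x \<and> (\<forall>z. R z = 0 \<longrightarrow> cinner y z = 0)"
    have "R (y - (x - m)) = 0" using y m by (simp add: R.diff)
    then have "cinner (y - (x - m)) (y - (x - m)) = 0"
      using y orth by (simp add: cinner_diff_left[of y])
    then show "y = x - m" by (simp add: cinner_self_eq_0)
  qed
  moreover have "norm (x - m) \<le> norm x"
  proof -
    have "cinner (x - m) (x - m) = cinner (x - m) x"
      using orth[OF m] by (simp add: cinner_diff_right)
    then have "complex_of_real ((norm (x - m))\<^sup>2) = cinner (x - m) x" by (simp add: cinner_norm)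
    then have "(norm (x - m))\<^sup>2 = cmod (cinner (x - m) x)"
      by (metis abs_power2 norm_of_real)
    also have "\<dots> \<le> norm (x - m) * norm x" by (rule Cauchy_Schwarz_cinner)
    finally show ?thesis by (cases "x = m") (simp_all add: power2_eq_square)
  qed
  ultimately show ?thesis by simp
qed

lemma hilbert_schmidt_comp_bounded:
  fixes R B :: "'a::complex_hilbert \<Rightarrow> 'a"
  assumes R: "bounded_clinear R" and B: "hilbert_schmidt (range R) (range_inner R) B"
  shows "bounded_clinear (B \<circ> R)"
proof -
  interpret R: bounded_linear R using R by (simp add: bounded_clinear_def)
  have hom: "B (R (c *\<^sub>C x)) = c *\<^sub>C B (R x)" for c x
    using R B by (simp add: bounded_clinear_def hilbert_schmidt_def)
  obtain K where K: "\<And>x. norm (B (R x)) \<le> K * sqrt (Re (range_inner R (R x) (R x)))"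
    using B by (auto simp: hilbert_schmidt_def)
  have "bounded_linear (B \<circ> R)"
  proof (rule bounded_linear_intro)
    show "(B \<circ> R) (x + y) = (B \<circ> R) x + (B \<circ> R) y" for x y
      using B by (simp add: hilbert_schmidt_def R.add)
    show "(B \<circ> R) (r *\<^sub>R x) = r *\<^sub>R (B \<circ> R) x" for r x
      using hom[of "complex_of_real r" x] by (simp add: scaleC_of_real)
    show "norm ((B \<circ> R) x) \<le> norm x * \<bar>K\<bar>" for x
    proof -
      have "norm (B (R x)) \<le> K * norm (pseudo_inverse R (R x))"
        using K[of x] by (simp add: range_inner_def cinner_norm)
      also have "\<dots> \<le> \<bar>K\<bar> * norm x"
        by (intro mult_mono pseudo_inverse_norm_le R) auto
      finally show ?thesis by (simp add: mult.commute)
    qed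
  qed
  then show ?thesis using hom by (simp add: bounded_clinear_def)
qed

lemma noise_cov_scaleC:
  assumes "bounded_clinear (B \<circ> R)"
  shows "noise_cov R B (c *\<^sub>C y) = c *\<^sub>C noise_cov R B y"
proof -
  obtain T' where T': "\<And>x y. cinner ((B \<circ> R) x) y = cinner x (T' y)"
    by (rule bounded_clinear_adjoint_exists[OF assms]) blast
  have "adjoint_op UNIV (B \<circ> R) (c *\<^sub>C y) = c *\<^sub>C T' y"
    by (rule adjoint_op_eqI) (simp_all only: closure_UNIV cinner_scaleC_right T')
  moreover have "adjoint_op UNIV (B \<circ> R) = T'" using T' by (rule adjoint_op_UNIV_eq)
  ultimately show ?thesis using assms by (simp add: noise_cov_def bounded_clinear_def)
qed

lemma cinner_noise_cov_real:
  assumes "bounded_clinear (B \<circ> R)"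
  shows "cinner (noise_cov R B y) y \<in> \<real>"
proof -
  obtain T' where T': "\<And>x y. cinner ((B \<circ> R) x) y = cinner x (T' y)"
    by (rule bounded_clinear_adjoint_exists[OF assms]) blast
  have "adjoint_op UNIV (B \<circ> R) = T'" using T' by (rule adjoint_op_UNIV_eq)
  then have "cinner (noise_cov R B y) y = cinner (T' y) (T' y)"
    using T' by (simp add: noise_cov_def)
  then show ?thesis by (simp add: cinner_norm)
qed

section \<open>Stable semigroups\<close>

lemma stable_semigroup_bounded:
  assumes S: "C0_semigroup S" and "stable_at_zero S"
  obtains K where "K > 0" "\<And>t x. 0 \<le> t \<Longrightarrow> norm (S t x) \<le> K * norm x"
proof -
  obtain \<delta> where \<delta>: "\<delta> > 0" "\<And>x t. norm x < \<delta> \<Longrightarrow> 0 \<le> t \<Longrightarrow> norm (S t x) < 1"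
    using assms(2) unfolding stable_at_zero_def by (metis zero_less_one)
  have "norm (S t x) \<le> 2 / \<delta> * norm x" if "0 \<le> t" for t x
  proof (cases "x = 0")
    case False
    interpret St: bounded_linear "S t"
      using S that by (simp add: C0_semigroup_def bounded_clinear_def)
    define c where "c = \<delta> / (2 * norm x)"
    have c: "c > 0" using \<delta>(1) False by (simp add: c_def)
    have "norm (c *\<^sub>R x) < \<delta>" using \<delta>(1) False by (simp add: c_def)
    then have "norm (S t (c *\<^sub>R x)) < 1" using \<delta>(2) that by blast
    then have "c * norm (S t x) < 1" using c by (simp add: St.scaleR)
    then show ?thesis using \<delta>(1) False by (simp add: c_def field_simps)
  next
    case True
    interpret St: bounded_linear "S t"
      using S that by (simp add: C0_semigroup_def bounded_clinear_def)
    show ?thesis by (simp add: True St.zero)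
  qed
  then show ?thesis using that[of "2 / \<delta>"] \<delta>(1) by simp
qed

text \<open>
  The bound \<open>K\<close> transports continuity at \<open>0\<close> to every time, including continuity from the left,
  since \<open>S t x - S s x = S s (S (t - s) x - x)\<close>.
\<close>

lemma orbit_continuous:
  assumes S: "C0_semigroup S" and bdd: "\<And>t x. 0 \<le> t \<Longrightarrow> norm (S t x) \<le> K * norm x"
    and K: "K > 0"
  shows "continuous_on {0..} (\<lambda>t. S t x)"
proof -
  have diff: "norm (S t x - S s x) \<le> K * norm (S (t - s) x - x)" if "0 \<le> s" "s \<le> t" for s t
  proof -
    interpret Ss: bounded_linear "S s"
      using S that by (simp add: C0_semigroup_def bounded_clinear_def)
    have "S t x = S s (S (t - s) x)"
      using S that unfolding C0_semigroup_def by (metis add.commute diff_add_cancel diff_ge_0_iff_ge)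
    then have "S t x - S s x = S s (S (t - s) x - x)" by (simp add: Ss.diff)
    then show ?thesis using bdd that by simp
  qed
  show ?thesis
    unfolding continuous_on_iff
  proof (intro ballI allI impI)
    fix s e :: real assume s: "s \<in> {0..}" and e: "0 < e"
    have "((\<lambda>t. S t x) \<longlongrightarrow> x) (at_right 0)" using S by (simp add: C0_semigroup_def)
    then have "eventually (\<lambda>h. dist (S h x) x < e / K) (at_right 0)"
      using e K by (simp add: tendsto_iff)
    then obtain b where b: "b > 0" "\<And>h. 0 < h \<Longrightarrow> h < b \<Longrightarrow> dist (S h x) x < e / K"
      by (auto simp: eventually_at_right_field)
    have S0: "S 0 x = x" using S by (simp add: C0_semigroup_def)
    have step: "norm (S (t - r) x - x) < e / K" if "r \<le> t" "t - r < b" for r t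
      using b(2)[of "t - r"] that e K S0 by (cases "r = t") (auto simp: dist_norm)
    have main: "norm (S t x - S r x) < e" if "0 \<le> r" "r \<le> t" "t - r < b" for r t
      using diff[OF that(1,2)] step[OF that(2,3)] K by (smt (verit) mult.commute pos_less_divide_eq)
    have "dist (S t x) (S s x) < e" if "t \<in> {0..}" "dist t s < b" for t
      using main[of s t] main[of t s] that s
      by (cases "s \<le> t") (auto simp: dist_norm norm_minus_commute)
    then show "\<exists>d>0. \<forall>t\<in>{0..}. dist t s < d \<longrightarrow> dist (S t x) (S s x) < e" using b(1) by blast
  qed
qed

lemma has_vector_derivative_right_limit:
  fixes F :: "real \<Rightarrow> 'b::real_normed_vector"
  assumes "(F has_vector_derivative v) (at r within {r..})"
  shows "((\<lambda>h. (F (r + h) - F r) /\<^sub>R h) \<longlongrightarrow> v) (at_right 0)"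
proof -
  have "((\<lambda>y. (F y - F r) /\<^sub>R (y - r)) \<longlongrightarrow> v) (at_right r)"
  proof (rule Lim_transform_eventually)
    have "((\<lambda>y. (1 / norm (y - r)) *\<^sub>R (F y - (F r + (y - r) *\<^sub>R v))) \<longlongrightarrow> 0) (at_right r)"
      using assms unfolding has_vector_derivative_def has_derivative_within
      by (auto elim: tendsto_within_subset)
    then show "((\<lambda>y. (1 / norm (y - r)) *\<^sub>R (F y - (F r + (y - r) *\<^sub>R v)) + v) \<longlongrightarrow> v) (at_right r)"
      using tendsto_add[OF _ tendsto_const[of v]] by fastforce
    show "eventually (\<lambda>y. (1 / norm (y - r)) *\<^sub>R (F y - (F r + (y - r) *\<^sub>R v)) + v
        = (F y - F r) /\<^sub>R (y - r)) (at_right r)"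
      by (rule eventually_mono[OF eventually_at_right_less])
        (simp add: scaleR_diff_right scaleR_add_right divide_inverse)
  qed
  then show ?thesis by (simp add: at_right_to_0[of r] filterlim_filtermap add.commute)
qed

lemma orbit_integral_derivative:
  fixes f :: "real \<Rightarrow> 'b::banach"
  assumes "continuous_on {0..} f" "0 \<le> r"
  shows "((\<lambda>t. integral {0..t} f) has_vector_derivative f r) (at r within {0..})"
proof -
  have "((\<lambda>t. integral {0..t} f) has_vector_derivative f r) (at r within {0..r + 1})"
    using assms by (intro integral_has_vector_derivative) (auto intro: continuous_on_subset)
  moreover have "at r within {0..r + 1} = at r within {0..}"
    by (rule at_within_nhd[of _ "{..<r + 1}"]) auto
  ultimately show ?thesis by simp
qed

text \<open>
  Applying \<open>S h\<close> shifts the interval of integration by \<open>h\<close>. The difference quotient is then a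
  difference of two mean values of the orbit, one near \<open>r\<close> and one near \<open>0\<close>,
  and these converge by continuity.
\<close>

lemma orbit_integral_in_domain:
  assumes gen: "generates D A S" and cont: "continuous_on {0..} (\<lambda>t. S t x)" and r: "0 \<le> r"
  shows "integral {0..r} (\<lambda>s. S s x) \<in> D"
    and "A (integral {0..r} (\<lambda>s. S s x)) = S r x - x"
proof -
  have S: "C0_semigroup S" using gen by (simp add: generates_def)
  define F where "F = (\<lambda>t. integral {0..t} (\<lambda>s. S s x))"
  have int: "(\<lambda>s. S s x) integrable_on {a..b}" if "0 \<le> a" for a b
    using that by (intro integrable_continuous_real continuous_on_subset[OF cont]) auto
  have eq: "S h (F r) - F r = (F (r + h) - F r) - (F (0 + h) - F 0)" if h: "0 < h" for h
  proof -
    have Sh: "bounded_linear (S h)" using S h by (simp add: C0_semigroup_def bounded_clinear_def)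
    have "S h (F r) = integral {0..r} (\<lambda>s. S h (S s x))"
      unfolding F_def using integral_linear[OF int Sh, of 0 r] by (simp add: o_def)
    also have "\<dots> = integral {0..r} (\<lambda>s. S (s + h) x)"
    proof (rule integral_cong)
      fix s assume "s \<in> {0..r}"
      then show "S h (S s x) = S (s + h) x"
        using S h unfolding C0_semigroup_def by (metis add.commute atLeastAtMost_iff less_imp_le)
    qed
    also have "\<dots> = integral {h..r + h} (\<lambda>s. S s x)"
      using integral_shift_Icc_real[of 0 r "\<lambda>s. S s x" h] by (simp add: o_def add.commute)
    also have "\<dots> = F (r + h) - F h"
      unfolding F_def
      using Henstock_Kurzweil_Integration.integral_combine[of 0 h "r + h" "\<lambda>s. S s x"] int h r by (simp add: algebra_simps)
    finally show ?thesis by (simp add: F_def)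
  qed
  have der: "((\<lambda>h. (F (t + h) - F t) /\<^sub>R h) \<longlongrightarrow> S t x) (at_right 0)" if "0 \<le> t" for t
    using that unfolding F_def
    by (intro has_vector_derivative_right_limit
        has_vector_derivative_within_subset[OF orbit_integral_derivative[OF cont]]) auto
  have "((\<lambda>h. (F (r + h) - F r) /\<^sub>R h - (F (0 + h) - F 0) /\<^sub>R h) \<longlongrightarrow> S r x - S 0 x) (at_right 0)"
    by (intro tendsto_diff der r) simp
  moreover have "eventually (\<lambda>h. (F (r + h) - F r) /\<^sub>R h - (F (0 + h) - F 0) /\<^sub>R h
      = (S h (F r) - F r) /\<^sub>R h) (at_right 0)"
    by (rule eventually_mono[OF eventually_at_right_less]) (simp only: eq scaleR_diff_right)
  moreover have "S 0 x = x" using S by (simp add: C0_semigroup_def)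
  ultimately have lim: "((\<lambda>h. (S h (F r) - F r) /\<^sub>R h) \<longlongrightarrow> S r x - x) (at_right 0)"
    by (simp add: tendsto_cong)
  then show FD: "integral {0..r} (\<lambda>s. S s x) \<in> D"
    using gen unfolding generates_def F_def by blast
  then have "((\<lambda>h. (S h (F r) - F r) /\<^sub>R h) \<longlongrightarrow> A (F r)) (at_right 0)"
    using gen unfolding generates_def F_def by blast
  with lim show "A (integral {0..r} (\<lambda>s. S s x)) = S r x - x"
    using tendsto_unique[OF _ _ lim] by (simp add: F_def)
qed

text \<open>The mean values of an orbit over short intervals lie in the domain and tend to its origin.\<close>

lemma generator_domain_dense:
  assumes gen: "generates D A S" and cont: "\<And>x. continuous_on {0..} (\<lambda>t. S t x)"
  shows "closure D = UNIV"
proof -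
  have S: "C0_semigroup S" using gen by (simp add: generates_def)
  have scale: "c *\<^sub>R y \<in> D" if y: "y \<in> D" for c y
  proof -
    have "((\<lambda>h. c *\<^sub>R ((S h y - y) /\<^sub>R h)) \<longlongrightarrow> c *\<^sub>R A y) (at_right 0)"
      using gen y unfolding generates_def by (intro tendsto_intros) blast
    moreover have "eventually (\<lambda>h. c *\<^sub>R ((S h y - y) /\<^sub>R h)
        = (S h (c *\<^sub>R y) - c *\<^sub>R y) /\<^sub>R h) (at_right 0)"
    proof (rule eventually_mono[OF eventually_at_right_less])
      fix h :: real assume "0 < h"
      then interpret Sh: bounded_linear "S h"
        using S by (simp add: C0_semigroup_def bounded_clinear_def)
      show "c *\<^sub>R ((S h y - y) /\<^sub>R h) = (S h (c *\<^sub>R y) - c *\<^sub>R y) /\<^sub>R h"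
        by (simp add: Sh.scaleR scaleR_right_diff_distrib mult.commute)
    qed
    ultimately have "((\<lambda>h. (S h (c *\<^sub>R y) - c *\<^sub>R y) /\<^sub>R h) \<longlongrightarrow> c *\<^sub>R A y) (at_right 0)"
      by (simp add: tendsto_cong)
    then show ?thesis using gen unfolding generates_def by blast
  qed
  have "x \<in> closure D" for x
  proof (rule Lim_in_closed_set)
    let ?F = "\<lambda>h. integral {0..h} (\<lambda>s. S s x)"
    have "((\<lambda>h. (?F (0 + h) - ?F 0) /\<^sub>R h) \<longlongrightarrow> S 0 x) (at_right 0)"
      by (intro has_vector_derivative_right_limit orbit_integral_derivative cont) simp
    then show "((\<lambda>h. ?F h /\<^sub>R h) \<longlongrightarrow> x) (at_right 0)"
      using S by (simp add: C0_semigroup_def)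
    show "eventually (\<lambda>h. ?F h /\<^sub>R h \<in> closure D) (at_right 0)"
      by (rule eventually_mono[OF eventually_at_right_less], rule subsetD[OF closure_subset],
          intro scale orbit_integral_in_domain(1)[OF gen cont]) simp
  qed simp_all
  then show ?thesis by blast
qed

text \<open>
  Pairing the identity for the integrated orbit with \<open>v\<close> gives the scalar integral equation
  \<open>\<phi>(t) = \<phi>(0) + \<mu> \<integral>\<^sub>0\<^sup>t \<phi>\<close>, whose only continuous solution is \<open>exp (\<mu> t) \<phi>(0)\<close>. Working with the
  integrated orbit covers every \<open>x\<close> at once, not just those in the domain.
\<close>

lemma cinner_orbit_adjoint_eigenvector:
  assumes gen: "generates D A S" and cont: "\<And>x. continuous_on {0..} (\<lambda>t. S t x)"
    and eig: "eigenvector (adj_domain D A) (adjoint_op D A) (cnj \<mu>) v" and t: "0 \<le> t"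
  shows "cinner (S t x) v = exp (\<mu> * of_real t) * cinner x v"
proof -
  define F where "F = (\<lambda>r. integral {0..r} (\<lambda>s. S s x))"
  have pair: "cinner (A y) v = \<mu> * cinner y v" if "y \<in> D" for y
    using cinner_adjoint_op[OF generator_domain_dense[OF gen cont] _ that, of v] eig
    by (simp add: eigenvector_def cinner_scaleC_right)
  have volterra: "cinner (S r x) v = cinner x v + \<mu> * cinner (F r) v" if "0 \<le> r" for r
    using pair[OF orbit_integral_in_domain(1)[OF gen cont that]]
      orbit_integral_in_domain(2)[OF gen cont that]
    by (simp add: F_def cinner_diff_left algebra_simps)
  \<comment> \<open>Integrating factor; \<open>E\<close> is constant on \<open>[0, \<infinity>)\<close>.\<close>
  define E where "E = (\<lambda>r. exp (- \<mu> * of_real r) * (cinner x v + \<mu> * cinner (F r) v))"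
  have "(E has_vector_derivative 0) (at r within {0..})" if r: "r \<in> {0..}" for r
  proof -
    have dF: "((\<lambda>r. cinner (F r) v) has_vector_derivative cinner (S r x) v) (at r within {0..})"
      using r unfolding F_def
      by (intro bounded_linear.has_vector_derivative[OF bounded_linear_cinner_left]
          orbit_integral_derivative cont) simp
    have dexp: "((\<lambda>r. exp (- \<mu> * of_real r)) has_vector_derivative
        - \<mu> * exp (- \<mu> * of_real r)) (at r within {0..})"
      by (rule has_vector_derivative_real_field) (auto intro!: derivative_eq_intros)
    have "(E has_vector_derivative
        exp (- \<mu> * of_real r) * (0 + \<mu> * cinner (S r x) v)
        + - \<mu> * exp (- \<mu> * of_real r) * (cinner x v + \<mu> * cinner (F r) v)) (at r within {0..})"
      unfolding E_def
      by (intro has_vector_derivative_mult dexp has_vector_derivative_add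
          has_vector_derivative_const has_vector_derivative_mult_right dF)
    moreover have "exp (- \<mu> * of_real r) * (0 + \<mu> * cinner (S r x) v)
        + - \<mu> * exp (- \<mu> * of_real r) * (cinner x v + \<mu> * cinner (F r) v) = 0"
      using volterra[of r] r by simp
    ultimately show ?thesis by metis
  qed
  then obtain c where c: "\<And>r. r \<in> {0..} \<Longrightarrow> E r = c"
    using has_vector_derivative_zero_constant[of "{0..}" E] by auto
  have "E t = E 0" using c t by simp
  then have "exp (- \<mu> * of_real t) * cinner (S t x) v = cinner x v"
    using volterra[OF t] by (simp add: E_def F_def)
  then show ?thesis by (auto simp: exp_minus field_simps)
qed

section \<open>Variance in the direction of an adjoint eigenvector\<close>

text \<open>
  An adjoint eigenvector diagonalises the covariance integral: in its direction the integrand is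
  \<open>exp (2 Re \<mu> \<tau>) \<langle>C v, v\<rangle>\<close>, as for a scalar Ornstein--Uhlenbeck process. The integral over
  \<open>[0, \<infinity>)\<close> is the factor \<open>- 1 / (2 Re \<mu>)\<close>.
\<close>

lemma stationary_variance_adjoint_eigenvector:
  assumes gen: "generates D A S" and stable: "stable_at_zero S"
    and eig: "eigenvector (adj_domain D A) (adjoint_op D A) (cnj \<mu>) v" and neg: "Re \<mu> < 0"
    and C: "\<And>c y. C (c *\<^sub>C y) = c *\<^sub>C C y"
    and lim: "((\<lambda>t. solution_cov S C s t v) \<longlongrightarrow> V) at_top"
  shows "cinner V v = of_real (- (s\<^sup>2 / (2 * Re \<mu>))) * cinner (C v) v"
proof -
  have S: "C0_semigroup S" using gen by (simp add: generates_def)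
  have cont: "continuous_on {0..} (\<lambda>t. S t x)" for x
    by (rule stable_semigroup_bounded[OF S stable]) (rule orbit_continuous[OF S])
  note orbit = cinner_orbit_adjoint_eigenvector[OF gen cont eig]
  have adj: "adjoint_op UNIV (S \<tau>) v = exp (cnj \<mu> * of_real \<tau>) *\<^sub>C v" if "0 \<le> \<tau>" for \<tau>
  proof (rule adjoint_op_eqI)
    show "cinner (S \<tau> x) v = cinner x (exp (cnj \<mu> * of_real \<tau>) *\<^sub>C v)" for x
      by (simp add: orbit[OF that] cinner_scaleC_right exp_cnj)
  qed simp
  let ?f = "\<lambda>\<tau>. S \<tau> (C (adjoint_op UNIV (S \<tau>) v))"
  let ?a = "2 * Re \<mu>"
  have f: "?f \<tau> = exp (cnj \<mu> * of_real \<tau>) *\<^sub>C S \<tau> (C v)" if "0 \<le> \<tau>" for \<tau>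
    using S that by (simp add: adj C C0_semigroup_def bounded_clinear_def)
  have val: "cinner (solution_cov S C s t v) v
      = of_real (s\<^sup>2 * ((exp (?a * t) - 1) / ?a)) * cinner (C v) v" if t: "0 \<le> t" for t
  proof -
    have "continuous_on {0..t} (\<lambda>\<tau>. exp (cnj \<mu> * of_real \<tau>) *\<^sub>C S \<tau> (C v))"
      by (intro bounded_bilinear.continuous_on[OF bounded_bilinear_scaleC] continuous_intros
          continuous_on_subset[OF cont]) auto
    then have "continuous_on {0..t} ?f" by (rule continuous_on_eq) (simp add: f)
    then have int: "?f integrable_on {0..t}" by (rule integrable_continuous_real)
    have "cinner (integral {0..t} ?f) v = integral {0..t} (\<lambda>\<tau>. cinner (?f \<tau>) v)"
      using integral_linear[OF int bounded_linear_cinner_left, of v] by (simp add: o_def)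
    also have "\<dots> = integral {0..t} (\<lambda>\<tau>. of_real (exp (?a * \<tau>)) * cinner (C v) v)"
    proof (rule integral_cong)
      fix \<tau> assume "\<tau> \<in> {0..t}"
      then have \<tau>: "0 \<le> \<tau>" by simp
      have "exp (cnj \<mu> * of_real \<tau>) * exp (\<mu> * of_real \<tau>) = complex_of_real (exp (?a * \<tau>))"
        by (simp add: exp_add[symmetric] distrib_right[symmetric] complex_add_cnj add.commute
            exp_of_real[symmetric])
      then show "cinner (?f \<tau>) v = of_real (exp (?a * \<tau>)) * cinner (C v) v"
        by (simp only: f[OF \<tau>] cinner_scaleC_left orbit[OF \<tau>] mult.assoc[symmetric])
    qed
    also have "\<dots> = of_real ((exp (?a * t) - 1) / ?a) * cinner (C v) v"
    proof (rule integral_unique)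
      have "((\<lambda>\<tau>. exp (?a * \<tau>)) has_integral exp (?a * t) / ?a - exp (?a * 0) / ?a) {0..t}"
        using t neg by (intro fundamental_theorem_of_calculus)
          (auto intro!: derivative_eq_intros simp: has_real_derivative_iff_has_vector_derivative[symmetric])
      then have "((\<lambda>\<tau>. exp (?a * \<tau>)) has_integral (exp (?a * t) - 1) / ?a) {0..t}"
        by (simp add: diff_divide_distrib)
      then show "((\<lambda>\<tau>. complex_of_real (exp (?a * \<tau>)) * cinner (C v) v)
          has_integral of_real ((exp (?a * t) - 1) / ?a) * cinner (C v) v) {0..t}"
        by (intro has_integral_mult_left has_integral_of_real)
    qed
    finally show ?thesis
      by (simp add: solution_cov_def scaleC_of_real[symmetric] cinner_scaleC_left)
  qed
  have "((\<lambda>t. exp (?a * t)) \<longlongrightarrow> 0) at_top"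
    using neg by (intro filterlim_compose[OF exp_at_bot] 
        filterlim_tendsto_neg_mult_at_bot[OF tendsto_const] filterlim_ident) simp
  then have "((\<lambda>t. complex_of_real (s\<^sup>2 * ((exp (?a * t) - 1) / ?a)) * cinner (C v) v)
      \<longlongrightarrow> of_real (s\<^sup>2 * ((0 - 1) / ?a)) * cinner (C v) v) at_top"
    using neg by (intro tendsto_intros) auto
  moreover have "eventually (\<lambda>t. complex_of_real (s\<^sup>2 * ((exp (?a * t) - 1) / ?a)) * cinner (C v) v
      = cinner (solution_cov S C s t v) v) at_top"
    using eventually_ge_at_top[of 0] by eventually_elim (simp only: val)
  ultimately have "((\<lambda>t. cinner (solution_cov S C s t v) v)
      \<longlongrightarrow> of_real (s\<^sup>2 * ((0 - 1) / ?a)) * cinner (C v) v) at_top"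
    by (blast intro: Lim_transform_eventually)
  moreover have "((\<lambda>t. cinner (solution_cov S C s t v) v) \<longlongrightarrow> cinner V v) at_top"
    by (rule bounded_linear.tendsto[OF bounded_linear_cinner_left lim])
  ultimately show ?thesis using tendsto_unique[OF trivial_limit_at_top_linorder] by fastforce
qed

theorem theorem3p4:
  fixes D :: "real \<Rightarrow> 'a::complex_hilbert set"
    and A :: "real \<Rightarrow> 'a \<Rightarrow> 'a"
    and S :: "real \<Rightarrow> real \<Rightarrow> 'a \<Rightarrow> 'a"
    and Q Qhalf B :: "'a \<Rightarrow> 'a"
    and \<sigma> :: "real \<Rightarrow> real"
    and eigval :: "'k \<Rightarrow> real \<Rightarrow> complex"
    and u :: "'k \<Rightarrow> real \<Rightarrow> 'a"
    and kstar :: 'k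
    and ustar :: 'a
    and Vinf :: "real \<Rightarrow> 'a \<Rightarrow> 'a"
    and \<Xi> :: ereal
  assumes semigroup: "\<And>p. generates (D p) (A p) (S p)"
    and covariance: "nonneg_selfadjoint Q" "is_sqrt_op Qhalf Q"
    and noise_operator: "hilbert_schmidt (range Qhalf) (range_inner Qhalf) B"
    and noise_level: "\<And>p. \<sigma> p > 0"
    and stable: "\<And>p. p < 0 \<Longrightarrow> stable_at_zero (S p)"
    and Vinf: "\<And>p g. p < 0 \<Longrightarrow>
      ((\<lambda>t. solution_cov (S p) (noise_cov Qhalf B) (\<sigma> p) t g) \<longlongrightarrow> Vinf p g) at_top"
    and discrete: "\<And>p. discrete_spectrum (D p) (A p)"
    and eigenvalues: "\<And>p. spectrum (D p) (A p) = range (\<lambda>k. eigval k p)"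
    and eigenfunctions: "\<And>p k. eigenvector (D p) (A p) (eigval k p) (u k p)"
    and subcritical: "\<And>p k. p < 0 \<Longrightarrow> Re (eigval k p) < 0"
    and critical: "Re (eigval kstar 0) = 0"
    and critical_mode: "\<And>p. p < 0 \<Longrightarrow> u kstar p = ustar"
    and critical_mode_adjoint: "\<And>p. p < 0 \<Longrightarrow>
      eigenvector (adj_domain (D p) (A p)) (adjoint_op (D p) (A p)) (cnj (eigval kstar p)) ustar"
    and Xi: "((\<lambda>p. ereal ((\<sigma> p)\<^sup>2 / (2 * Re (eigval kstar p)))) \<longlongrightarrow> \<Xi>) (at_left 0)"
  shows "(\<forall>p<0. cinner (Vinf p ustar) ustar \<in> \<real>) \<and>
    cinner (noise_cov Qhalf B ustar) ustar \<in> \<real> \<and>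
    ((\<lambda>p. ereal (Re (cinner (Vinf p ustar) ustar))) \<longlongrightarrow>
      - ereal (Re (cinner (noise_cov Qhalf B ustar) ustar)) * \<Xi>) (at_left 0) \<and>
    (cinner (noise_cov Qhalf B ustar) ustar \<noteq> 0 \<longrightarrow>
      (\<lambda>p. cinner (Vinf p ustar) ustar) \<in>
        O[at_left 0](\<lambda>p. complex_of_real ((\<sigma> p)\<^sup>2 / Re (eigval kstar p))))"

proof -
  let ?C = "noise_cov Qhalf B"
  define b where "b = Re (cinner (?C ustar) ustar)"
  have bdd: "bounded_clinear (B \<circ> Qhalf)"
    using covariance(2) noise_operator
    by (intro hilbert_schmidt_comp_bounded) (simp_all add: is_sqrt_op_def nonneg_selfadjoint_def)
  have C_real: "cinner (?C ustar) ustar \<in> \<real>" by (rule cinner_noise_cov_real[OF bdd])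
  then have C_b: "cinner (?C ustar) ustar = of_real b" by (simp add: b_def)
  have var: "cinner (Vinf p ustar) ustar = of_real (- b * ((\<sigma> p)\<^sup>2 / (2 * Re (eigval kstar p))))"
    if "p < 0" for p
    using stationary_variance_adjoint_eigenvector[OF semigroup stable[OF that]
        critical_mode_adjoint[OF that] subcritical[OF that] noise_cov_scaleC[OF bdd] Vinf[OF that]]
    by (simp add: C_b mult.commute)
  have left: "eventually (\<lambda>p. p < 0) (at_left (0::real))"
    by (simp add: eventually_at_left_field) (metis lt_ex)
  \<comment> \<open>Multiplication by a finite constant is continuous on the extended reals, also at \<open>\<Xi> = - \<infinity>\<close>;
    for \<open>b = 0\<close> this agrees with the convention \<open>0 \<cdot> (- \<infinity>) = 0\<close>.\<close>
  have "((\<lambda>p. ereal (- b) * ereal ((\<sigma> p)\<^sup>2 / (2 * Re (eigval kstar p)))) \<longlongrightarrow> ereal (- b) * \<Xi>)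
      (at_left 0)"
    by (intro tendsto_cmult_ereal Xi) simp
  moreover have "eventually (\<lambda>p. ereal (- b) * ereal ((\<sigma> p)\<^sup>2 / (2 * Re (eigval kstar p)))
      = ereal (Re (cinner (Vinf p ustar) ustar))) (at_left 0)"
    using left by eventually_elim (simp add: var)
  ultimately have "((\<lambda>p. ereal (Re (cinner (Vinf p ustar) ustar))) \<longlongrightarrow> - ereal b * \<Xi>) (at_left 0)"
    by (auto intro: Lim_transform_eventually)
  moreover have "(\<lambda>p. cinner (Vinf p ustar) ustar)
      \<in> O[at_left 0](\<lambda>p. complex_of_real ((\<sigma> p)\<^sup>2 / Re (eigval kstar p)))"
  proof (rule bigoI)
    show "eventually (\<lambda>p. norm (cinner (Vinf p ustar) ustar)
        \<le> (\<bar>b\<bar> / 2) * norm (complex_of_real ((\<sigma> p)\<^sup>2 / Re (eigval kstar p)))) (at_left 0)"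
      using left by eventually_elim (simp only: var norm_of_real, simp add: abs_mult)
  qed
  ultimately show ?thesis using C_real var by (simp add: b_def)
qed

end
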